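(* Let $K$ be a field, $n>1$, $d>1$, $e\ge1$ integers, and let $1\le r\le d$ with $d!/(d-r)!\neq 0$ in $K$. Let $A=K[x_1,\dots,x_n]$. If $\mathcal T$ is an $(e+1)$-independent set of at least $re+1$ nonzero subspaces of $A_1$, then $\{\langle T^d\rangle\mid T\in\mathcal T\}$ is an $(re+1)$-independent set of subspaces of $A_d$: for any $re+1$ distinct members $T_0,\dots,T_{re}$ of $\mathcal T$, the sum $\sum_{i}\langle T_i^d\rangle$ is direct.
   Context: $A_m$ denotes the space of homogeneous polynomials of degree $m$ in $A$. For a subset $T\subseteq A$, $\langle T^d\rangle$ is the subspace spanned by all products of $d$ elements of $T$. A set of at least $k$ subspaces is $k$-independent if the subspace spanned by any $k$ distinct members is their direct sum. *)

theory Defs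
  imports Complex_Main "HOL-Library.Poly_Mapping" "HOL-Library.FuncSet"
begin

text \<open>Polynomials in the variables \<open>x\<^sub>0, x\<^sub>1, \<dots>\<close>: finitely supported maps from exponent vectors to
  coefficients. The ring \<open>K[x\<^sub>0, \<dots>, x\<^sub>n\<^sub>-\<^sub>1]\<close> is the subring \<open>polys n\<close>.\<close>

type_synonym 'a mpoly = "(nat \<Rightarrow>\<^sub>0 nat) \<Rightarrow>\<^sub>0 'a"

definition scale_mpoly :: "'a::comm_ring_1 \<Rightarrow> 'a mpoly \<Rightarrow> 'a mpoly" where
  "scale_mpoly c p = Poly_Mapping.single 0 c * p"

interpretation mpoly: vector_space "scale_mpoly :: 'a::field \<Rightarrow> 'a mpoly \<Rightarrow> 'a mpoly"
  by unfold_locales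
    (simp_all add: scale_mpoly_def distrib_left distrib_right single_add mult_single
      flip: mult.assoc)

definition polys :: "nat \<Rightarrow> 'a::zero mpoly set" where
  "polys n = {p. \<forall>u\<in>Poly_Mapping.keys p. Poly_Mapping.keys u \<subseteq> {..<n}}"

text \<open>\<open>homogeneous n m\<close> is the space \<open>A\<^sub>m\<close> for \<open>A = polys n\<close>; it contains \<open>0\<close>.\<close>

definition homogeneous :: "nat \<Rightarrow> nat \<Rightarrow> 'a::zero mpoly set" where
  "homogeneous n m =
     {p \<in> polys n. \<forall>u\<in>Poly_Mapping.keys p. (\<Sum>i<n. Poly_Mapping.lookup u i) = m}"

definition power_span :: "nat \<Rightarrow> 'a::field mpoly set \<Rightarrow> 'a mpoly set" where
  "power_span d T = mpoly.span {\<Prod>i<d. t i | t. \<forall>i<d. t i \<in> T}"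

text \<open>The span of the subspaces \<open>U i\<close>, \<open>i \<in> I\<close>, is their (internal) direct sum: the
  addition map from the external direct sum is bijective onto the span. Only meant for finite \<open>I\<close>.\<close>

definition direct_sum_family :: "('i \<Rightarrow> 'a::field mpoly set) \<Rightarrow> 'i set \<Rightarrow> bool" where
  "direct_sum_family U I \<longleftrightarrow>
     bij_betw (\<lambda>f. \<Sum>i\<in>I. f i) (\<Pi>\<^sub>E i\<in>I. U i) (mpoly.span (\<Union>i\<in>I. U i))"

text \<open>The condition \<open>finite \<S> \<longrightarrow> k \<le> card \<S>\<close> expresses that \<open>\<S>\<close>, which may be
  infinite, has at least \<open>k\<close> members.\<close>

definition k_independent :: "nat \<Rightarrow> 'a::field mpoly set set \<Rightarrow> bool" where
  "k_independent k \<S> \<longleftrightarrow>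
     (\<forall>U\<in>\<S>. mpoly.subspace U) \<and>
     (finite \<S> \<longrightarrow> k \<le> card \<S>) \<and>
     (\<forall>F. F \<subseteq> \<S> \<and> finite F \<and> card F = k \<longrightarrow> direct_sum_family (\<lambda>U. U) F)"

end

theory Submission
  imports Defs
begin

text \<open>Suppose \<open>f + (\<Sum>U\<in>S. g U) = 0\<close> with \<open>f \<in> \<langle>T\<^sup>d\<rangle>\<close>, \<open>g U \<in> \<langle>U\<^sup>d\<rangle>\<close> and \<open>S\<close> consisting of
  \<open>r e\<close> members of \<open>\<T>\<close>. Choose \<open>B \<subseteq> S\<close> of size \<open>e\<close>. As \<open>T\<close> meets the span of \<open>\<Union>B\<close> trivially, every
  linear functional on \<open>T\<close> is induced by a derivation \<open>D\<close> with constant coefficients that kills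
  \<open>\<langle>U\<^sup>d\<rangle>\<close> for all \<open>U \<in> B\<close>. Applying \<open>D\<close> lowers the degree by one and removes \<open>e\<close> summands, so
  \<open>D f = 0\<close> by induction on \<open>r\<close>. Letting \<open>D\<close> range over the dual of a basis \<open>Y\<close> of \<open>T\<close>, Euler's
  identity \<open>d f = (\<Sum>y\<in>Y. y D\<^sub>y f)\<close> gives \<open>f = 0\<close>.\<close>

section \<open>Derivations of the polynomial ring\<close>

lemma poly_mapping_monomial_induct [case_names zero monomial add]:
  fixes p :: "'b \<Rightarrow>\<^sub>0 'a::comm_monoid_add"
  assumes "P 0" and "\<And>u a. P (Poly_Mapping.single u a)" and "\<And>p q. P p \<Longrightarrow> P q \<Longrightarrow> P (p + q)"
  shows "P p"
proof (induction p rule: update_induct)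
  case const
  then show ?case using assms(1) by simp
next
  case (update p u a)
  have "Poly_Mapping.update u a p = Poly_Mapping.single u a + p"
    using update.hyps(1)
    by (intro poly_mapping_eqI)
      (auto simp: lookup_update lookup_add lookup_single in_keys_iff when_def)
  then show ?case using assms(2,3) update by simp
qed

text \<open>The sum over \<open>k\<close> of \<open>c k\<close> times the partial derivative along
  variable \<open>k\<close>. Where truncated subtraction would spoil the exponent, the factor
  \<open>lookup u k\<close> is zero.\<close>

definition derivation :: "nat \<Rightarrow> (nat \<Rightarrow> 'a) \<Rightarrow> 'a::comm_ring_1 mpoly \<Rightarrow> 'a mpoly" where
  "derivation n c p = (\<Sum>u\<in>Poly_Mapping.keys p. \<Sum>k<n.
     Poly_Mapping.single (u - Poly_Mapping.single k 1)
       (Poly_Mapping.lookup p u * (of_nat (Poly_Mapping.lookup u k) * c k)))"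

lemma derivation_single:
  "derivation n c (Poly_Mapping.single u a) =
     (\<Sum>k<n. Poly_Mapping.single (u - Poly_Mapping.single k 1)
        (a * (of_nat (Poly_Mapping.lookup u k) * c k)))"
  by (cases "a = 0") (simp_all add: derivation_def)

lemma derivation_0 [simp]: "derivation n c 0 = 0"
  by (simp add: derivation_def)

lemma derivation_add: "derivation n c (p + q) = derivation n c p + derivation n c q"
  unfolding derivation_def
  by (rule setsum_keys_plus_distrib) (simp_all add: distrib_right single_add sum.distrib)

lemma derivation_sum: "derivation n c (\<Sum>i\<in>I. f i) = (\<Sum>i\<in>I. derivation n c (f i))"
  by (induction I rule: infinite_finite_induct) (simp_all add: derivation_add)

lemma derivation_mult_single:
  "derivation n c (Poly_Mapping.single u a * Poly_Mapping.single v b) =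
     derivation n c (Poly_Mapping.single u a) * Poly_Mapping.single v b
     + Poly_Mapping.single u a * derivation n c (Poly_Mapping.single v b)"
proof -
  have shift: "u + v - Poly_Mapping.single k 1 = (u - Poly_Mapping.single k 1) + v"
    if "Poly_Mapping.lookup u k \<noteq> 0" for u v :: "nat \<Rightarrow>\<^sub>0 nat" and k
    using that
    by (intro poly_mapping_eqI) (auto simp: lookup_add lookup_minus lookup_single when_def)
  have left: "Poly_Mapping.single (u + v - Poly_Mapping.single k 1)
        (a * b * (of_nat (Poly_Mapping.lookup u k) * c k)) =
      Poly_Mapping.single (u - Poly_Mapping.single k 1)
        (a * (of_nat (Poly_Mapping.lookup u k) * c k)) * Poly_Mapping.single v b"
    for u v a b k
    using shift[of u k v]
    by (cases "Poly_Mapping.lookup u k = 0") (simp_all add: mult_single ac_simps)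
  have right: "Poly_Mapping.single (u + v - Poly_Mapping.single k 1)
        (a * b * (of_nat (Poly_Mapping.lookup v k) * c k)) =
      Poly_Mapping.single u a * Poly_Mapping.single (v - Poly_Mapping.single k 1)
        (b * (of_nat (Poly_Mapping.lookup v k) * c k))" for k
    using left[where u = v and v = u and a = b and b = a] by (simp add: ac_simps)
  show ?thesis
    unfolding mult_single derivation_single lookup_add of_nat_add distrib_right distrib_left
      single_add sum.distrib sum_distrib_left sum_distrib_right left right
    by simp
qed

text \<open>Both sides are additive in each factor, so two nested inductions reduce the product rule
  to monomials.\<close>

lemma derivation_mult:
  "derivation n c (p * q) = derivation n c p * q + p * derivation n c q"
proof (induction p rule: poly_mapping_monomial_induct)
  case zero
  then show ?case by simp
next
  case (monomial u a)
  show ?case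
    by (induction q rule: poly_mapping_monomial_induct)
      (simp_all add: derivation_mult_single derivation_add algebra_simps)
next
  case (add p p')
  then show ?case by (simp add: derivation_add algebra_simps)
qed

lemma derivation_constant [simp]: "derivation n c (Poly_Mapping.single 0 a) = 0"
  by (simp add: derivation_single)

lemma derivation_1 [simp]: "derivation n c 1 = 0"
  using derivation_constant[of n c 1] unfolding single_one .

lemma derivation_scale: "derivation n c (scale_mpoly a p) = scale_mpoly a (derivation n c p)"
  by (simp add: scale_mpoly_def derivation_mult)

lemma scale_mpoly_one: "scale_mpoly a 1 = Poly_Mapping.single 0 a"
  by (simp add: scale_mpoly_def)

lemma scale_mpoly_mult_left: "scale_mpoly a p * q = scale_mpoly a (p * q)"
  by (simp add: scale_mpoly_def mult.assoc)

lemma scale_mpoly_mult_right: "p * scale_mpoly a q = scale_mpoly a (p * q)"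
  by (simp add: scale_mpoly_def ac_simps)

section \<open>Linear forms and products of linear forms\<close>

lemma subspace_homogeneous: "mpoly.subspace (homogeneous n m :: 'a::field mpoly set)"
proof -
  have "Poly_Mapping.keys (scale_mpoly a p) \<subseteq> Poly_Mapping.keys p" for a :: 'a and p
    using keys_mult[of "Poly_Mapping.single 0 a" p] unfolding scale_mpoly_def
    by (auto split: if_splits)
  then show ?thesis
    unfolding mpoly.subspace_def homogeneous_def polys_def
    using keys_add by fastforce
qed

lemma homogeneous_mult:
  assumes "p \<in> homogeneous n a" and "q \<in> homogeneous n b"
  shows "p * q \<in> homogeneous n (a + b)"
proof -
  have "Poly_Mapping.keys (u + v) \<subseteq> {..<n} \<and> (\<Sum>i<n. Poly_Mapping.lookup (u + v) i) = a + b"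
    if "u \<in> Poly_Mapping.keys p" "v \<in> Poly_Mapping.keys q" for u v
    using that assms keys_add[of u v]
    by (fastforce simp: homogeneous_def polys_def lookup_add sum.distrib)
  then show ?thesis
    using keys_mult[of p q] unfolding homogeneous_def polys_def by fastforce
qed

lemma homogeneous_prod:
  fixes t :: "nat \<Rightarrow> 'a::field mpoly"
  assumes "\<forall>i<d. t i \<in> homogeneous n 1"
  shows "(\<Prod>i<d. t i) \<in> homogeneous n d"
  using assms
proof (induction d)
  case 0
  then show ?case by (simp add: homogeneous_def polys_def)
next
  case (Suc d)
  then show ?case
    using homogeneous_mult[of "\<Prod>i<d. t i" n d "t d" 1] by simp
qed

lemma subspace_power_span: "mpoly.subspace (power_span d T)"
  by (simp add: power_span_def mpoly.subspace_span)

lemma power_span_subset_homogeneous: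
  "T \<subseteq> homogeneous n 1 \<Longrightarrow> power_span d T \<subseteq> homogeneous n d"
  unfolding power_span_def
  by (intro mpoly.span_minimal subspace_homogeneous) (auto intro!: homogeneous_prod)

lemma homogeneous_1_subset_span:
  "homogeneous n 1 \<subseteq> mpoly.span ((\<lambda>k. Poly_Mapping.single (Poly_Mapping.single k 1) 1) ` {..<n})"
    (is "_ \<subseteq> mpoly.span ?X")
proof
  fix p :: "'a mpoly"
  assume p: "p \<in> homogeneous n 1"
  have "Poly_Mapping.single u (Poly_Mapping.lookup p u) \<in> mpoly.span ?X"
    if u: "u \<in> Poly_Mapping.keys p" for u
  proof -
    have "Poly_Mapping.keys u \<subseteq> {..<n}" and "(\<Sum>i<n. Poly_Mapping.lookup u i) = 1"
      using p u by (auto simp: homogeneous_def polys_def)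
    \<comment> \<open>Naturals with sum 1 are all zero except for a single 1, so \<open>u\<close> is
      the exponent vector of a variable.\<close>
    then obtain k where k: "k < n" "Poly_Mapping.lookup u k = 1"
        "\<forall>i\<in>{..<n}. k \<noteq> i \<longrightarrow> Poly_Mapping.lookup u i = 0"
      using sum_eq_1_iff[of "{..<n}" "Poly_Mapping.lookup u"] by auto
    have "u = Poly_Mapping.single k 1"
      using k \<open>Poly_Mapping.keys u \<subseteq> {..<n}\<close>
      by (intro poly_mapping_eqI)
        (auto simp: lookup_single when_def in_keys_iff subset_iff)
    moreover have "scale_mpoly (Poly_Mapping.lookup p u)
        (Poly_Mapping.single (Poly_Mapping.single k 1) 1) \<in> mpoly.span ?X"
      using k(1) by (intro mpoly.span_scale mpoly.span_base) auto
    ultimately show ?thesis by (simp add: scale_mpoly_def mult_single)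
  qed
  moreover have "p = (\<Sum>u\<in>Poly_Mapping.keys p. Poly_Mapping.single u (Poly_Mapping.lookup p u))"
    by (intro poly_mapping_eqI)
      (auto simp: lookup_sum lookup_single when_def in_keys_iff)
  ultimately show "p \<in> mpoly.span ?X"
    by (metis (no_types, lifting) mpoly.span_sum)
qed

text \<open>A functional on linear forms is determined by its values on the variables. Taking these
  values as coefficients realises it by a derivation, which then also acts in higher
  degrees.\<close>

lemma derivation_linear_form:
  fixes \<phi> :: "'a::field mpoly \<Rightarrow> 'a"
  assumes add: "\<And>p q. \<phi> (p + q) = \<phi> p + \<phi> q"
    and scale: "\<And>a p. \<phi> (scale_mpoly a p) = a * \<phi> p"
    and p: "p \<in> homogeneous n 1"
  shows "derivation n (\<lambda>k. \<phi> (Poly_Mapping.single (Poly_Mapping.single k 1) 1)) p =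
    Poly_Mapping.single 0 (\<phi> p)" (is "derivation n ?c p = _")
proof -
  let ?V = "{p. derivation n ?c p = Poly_Mapping.single 0 (\<phi> p)}"
  have "\<phi> 0 = 0"
    using scale[of 0 0] by simp
  then have "mpoly.subspace ?V"
    by (auto simp: mpoly.subspace_def add scale derivation_add derivation_scale single_add)
      (simp add: scale_mpoly_def mult_single)
  moreover have "Poly_Mapping.single (Poly_Mapping.single k 1) 1 \<in> ?V" if "k < n" for k
  proof -
    have "Poly_Mapping.single (Poly_Mapping.single k 1 - Poly_Mapping.single j 1)
        (of_nat (Poly_Mapping.lookup (Poly_Mapping.single k 1) j) * ?c j) =
      (if k = j then Poly_Mapping.single 0 (?c k) else 0 :: 'a mpoly)" for j
      by (simp add: lookup_single when_def)
    then show ?thesis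
      using that by (simp add: derivation_single del: One_nat_def)
  qed
  ultimately have "homogeneous n 1 \<subseteq> ?V"
    by (intro order_trans[OF homogeneous_1_subset_span] mpoly.span_minimal image_subsetI) auto
  then show ?thesis using p by blast
qed

section \<open>The action of derivations on power spans\<close>

lemma power_span_mult:
  assumes "p \<in> power_span d T" and "t \<in> T"
  shows "p * t \<in> power_span (Suc d) T"
proof -
  let ?V = "{p. p * t \<in> power_span (Suc d) T}"
  have "mpoly.subspace ?V"
    using subspace_power_span[of "Suc d" T]
    by (auto simp: mpoly.subspace_def distrib_right scale_mpoly_mult_left)
  moreover have "(\<Prod>i<d. s i) \<in> ?V" if "\<forall>i<d. s i \<in> T" for s
  proof -
    have "(\<Prod>i<Suc d. (s(d := t)) i) \<in> power_span (Suc d) T"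
      unfolding power_span_def using that assms(2)
      by (intro mpoly.span_base CollectI exI[of _ "s(d := t)"]) auto
    then show ?thesis by simp
  qed
  ultimately have "power_span d T \<subseteq> ?V"
    unfolding power_span_def[of d] by (intro mpoly.span_minimal) auto
  then show ?thesis using assms(1) by blast
qed

text \<open>By the product rule, the derivative of a product of \<open>Suc d\<close> factors is a
  sum of terms in which one factor has become a constant and the other \<open>d\<close>
  remain.\<close>

lemma derivation_power_span:
  fixes T :: "'a::field mpoly set"
  assumes T: "\<And>t. t \<in> T \<Longrightarrow> \<exists>a. derivation n c t = Poly_Mapping.single 0 a"
    and p: "p \<in> power_span (Suc d) T"
  shows "derivation n c p \<in> power_span d T"
proof -
  have *: "derivation n c (\<Prod>i<Suc d. t i) \<in> power_span d T" if "\<forall>i<Suc d. t i \<in> T" for t d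
    using that
  proof (induction d)
    case 0
    \<comment> \<open>No factor remains here: the derivative is a constant, a multiple of the empty
      product that spans \<open>power_span 0 T\<close>.\<close>
    then obtain a where "derivation n c (t 0) = scale_mpoly a 1"
      using T[of "t 0"] by (auto simp: scale_mpoly_one)
    then show ?case
      by (simp add: power_span_def mpoly.span_base mpoly.span_scale)
  next
    case (Suc d)
    obtain a where a: "derivation n c (t (Suc d)) = Poly_Mapping.single 0 a"
      using T[of "t (Suc d)"] Suc.prems by auto
    have "(\<Prod>i<Suc d. t i) \<in> power_span (Suc d) T"
      unfolding power_span_def using Suc.prems by (intro mpoly.span_base) fastforce
    then have "scale_mpoly a (\<Prod>i<Suc d. t i) \<in> power_span (Suc d) T"
      by (rule mpoly.subspace_scale[OF subspace_power_span])
    moreover have "derivation n c (\<Prod>i<Suc d. t i) * t (Suc d) \<in> power_span (Suc d) T"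
      using Suc by (intro power_span_mult) auto
    ultimately have "derivation n c (\<Prod>i<Suc d. t i) * t (Suc d) + scale_mpoly a (\<Prod>i<Suc d. t i)
        \<in> power_span (Suc d) T"
      by (intro mpoly.subspace_add[OF subspace_power_span])
    then show ?case
      unfolding prod.lessThan_Suc[of t "Suc d"] derivation_mult a scale_mpoly_def
      by (simp only: mult.commute)
  qed
  have "mpoly.subspace {p. derivation n c p \<in> power_span d T}"
    using subspace_power_span[of d T]
    by (auto simp: mpoly.subspace_def derivation_add derivation_scale)
  then have "power_span (Suc d) T \<subseteq> {p. derivation n c p \<in> power_span d T}"
    unfolding power_span_def[of "Suc d"] using * by (intro mpoly.span_minimal) auto
  then show ?thesis using p by blast
qed

lemma derivation_power_span_eq_0:
  fixes T :: "'a::field mpoly set"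
  assumes T: "\<And>t. t \<in> T \<Longrightarrow> derivation n c t = 0" and p: "p \<in> power_span d T"
  shows "derivation n c p = 0"
proof -
  have "derivation n c (\<Prod>i<d. t i) = 0" if "\<forall>i<d. t i \<in> T" for t
    using that
  proof (induction d)
    case 0
    show ?case by simp
  next
    case (Suc d)
    then show ?case by (simp add: derivation_mult T)
  qed
  moreover have "mpoly.subspace {p. derivation n c p = 0}"
    by (auto simp: mpoly.subspace_def derivation_add derivation_scale)
  ultimately have "power_span d T \<subseteq> {p. derivation n c p = 0}"
    unfolding power_span_def by (intro mpoly.span_minimal) auto
  then show ?thesis using p by blast
qed

text \<open>A sum of derivations with polynomial multipliers is again a derivation. Being the
  identity on \<open>T\<close>, it multiplies each product of \<open>d\<close> elements of
  \<open>T\<close> by \<open>d\<close>.\<close>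

lemma euler_identity:
  fixes T :: "'a::field mpoly set"
  assumes T: "\<And>t. t \<in> T \<Longrightarrow> (\<Sum>y\<in>Y. y * derivation n (c y) t) = t" and p: "p \<in> power_span d T"
  shows "(\<Sum>y\<in>Y. y * derivation n (c y) p) = of_nat d * p"
proof -
  define E where "E p = (\<Sum>y\<in>Y. y * derivation n (c y) p)" for p
  have E_mult: "E (p * q) = E p * q + p * E q" for p q
    by (simp add: E_def derivation_mult sum.distrib sum_distrib_left sum_distrib_right
        distrib_left ac_simps)
  have "E (\<Prod>i<d. t i) = of_nat d * (\<Prod>i<d. t i)" if "\<forall>i<d. t i \<in> T" for t
    using that
  proof (induction d)
    case 0
    show ?case by (simp add: E_def)
  next
    case (Suc d)
    moreover have "E (t d) = t d"
      using Suc.prems T by (simp add: E_def)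
    ultimately show ?case by (simp add: E_mult algebra_simps)
  qed
  moreover have "mpoly.subspace {p. E p = of_nat d * p}"
    by (auto simp: mpoly.subspace_def E_def derivation_add derivation_scale sum.distrib
        distrib_left scale_mpoly_mult_right mpoly.scale_sum_right[symmetric])
  ultimately have "power_span d T \<subseteq> {p. E p = of_nat d * p}"
    unfolding power_span_def by (intro mpoly.span_minimal) auto
  then show ?thesis using p by (auto simp: E_def)
qed

section \<open>Dual bases relative to a complementary subspace\<close>

text \<open>A vanishing combination splits into a part in \<open>T\<close> and a part in
  \<open>W\<close>. They are negatives of each other, hence lie in the intersection and vanish, and
  independence applies to each separately.\<close>

lemma independent_Un_of_Int_eq_0:
  assumes C: "mpoly.independent C" "C \<subseteq> T" and D: "mpoly.independent D" "D \<subseteq> W"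
    and T: "mpoly.subspace T" and W: "mpoly.subspace W" and TW: "T \<inter> W \<subseteq> {0}"
  shows "mpoly.independent (C \<union> D)"
proof
  assume "mpoly.dependent (C \<union> D)"
  then obtain S u v where S: "finite S" "S \<subseteq> C \<union> D" "v \<in> S" "u v \<noteq> 0"
      "(\<Sum>v\<in>S. scale_mpoly (u v) v) = 0"
    unfolding mpoly.dependent_explicit by blast
  let ?s = "\<lambda>A. \<Sum>v\<in>A. scale_mpoly (u v) v"
  have split: "?s (S \<inter> C) + ?s (S - C) = 0"
    using S(1,5) sum.Int_Diff[of S "\<lambda>v. scale_mpoly (u v) v" C] by simp
  have "?s (S \<inter> C) \<in> T"
    using C(2) by (intro mpoly.subspace_sum[OF T] mpoly.subspace_scale[OF T]) auto
  moreover have "- ?s (S - C) \<in> W"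
    using S(2) D(2)
    by (intro mpoly.subspace_neg[OF W] mpoly.subspace_sum[OF W] mpoly.subspace_scale[OF W]) auto
  moreover have "?s (S \<inter> C) = - ?s (S - C)"
    using split by (simp add: eq_neg_iff_add_eq_0)
  ultimately have "?s (S \<inter> C) = 0"
    using TW by auto
  with split have zero: "?s (S \<inter> C) = 0" "?s (S - C) = 0"
    by auto
  have "u w = 0" if "w \<in> S" for w
  proof (cases "w \<in> C")
    case True
    then show ?thesis
      using mpoly.independentD[OF C(1) _ _ zero(1)] S(1) that by auto
  next
    case False
    then show ?thesis
      using mpoly.independentD[OF D(1) _ _ zero(2)] S(1,2) that by auto
  qed
  with S show False by blast
qed

text \<open>Bases \<open>Y\<close> of \<open>T\<close> and \<open>Z\<close> of \<open>W\<close> are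
  jointly independent, so the coordinate functionals of \<open>Y\<close> vanish on \<open>W\<close>;
  they induce the derivations. The last property is the expansion of an element of \<open>T\<close>
  in the basis \<open>Y\<close>, in the form Euler's identity needs.\<close>

lemma dual_derivations:
  fixes T W :: "'a::field mpoly set"
  assumes T: "mpoly.subspace T" "T \<subseteq> homogeneous n 1"
    and W: "mpoly.subspace W" "W \<subseteq> homogeneous n 1" and TW: "T \<inter> W \<subseteq> {0}"
  obtains c Y where
    "\<forall>y. \<forall>p\<in>homogeneous n 1. \<exists>a. derivation n (c y) p = Poly_Mapping.single 0 a"
    "\<forall>y\<in>Y. \<forall>p\<in>W. derivation n (c y) p = 0"
    "\<forall>p\<in>T. (\<Sum>y\<in>Y. y * derivation n (c y) p) = p"
proof -
  obtain Y where Y: "Y \<subseteq> T" "mpoly.independent Y" "T \<subseteq> mpoly.span Y"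
    by (rule mpoly.maximal_independent_subset)
  obtain Z where Z: "Z \<subseteq> W" "mpoly.independent Z" "W \<subseteq> mpoly.span Z"
    by (rule mpoly.maximal_independent_subset)
  have "mpoly.independent (Y \<union> Z)"
    by (rule independent_Un_of_Int_eq_0[OF Y(2,1) Z(2,1) T(1) W(1) TW])
  \<comment> \<open>Extending to a basis of the whole polynomial space makes the coordinate
    functionals linear everywhere, as \<open>derivation_linear_form\<close> demands.\<close>
  then obtain B where B: "Y \<union> Z \<subseteq> B" "mpoly.independent B" "UNIV \<subseteq> mpoly.span B"
    by (rule mpoly.maximal_independent_subset_extend[OF subset_UNIV])
  have "Y \<subseteq> mpoly.span ((\<lambda>k. Poly_Mapping.single (Poly_Mapping.single k 1) 1) ` {..<n})"
    using Y(1) T(2) homogeneous_1_subset_span by blast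
  then have "finite Y"
    using mpoly.independent_span_bound[OF _ Y(2)] by blast
  define \<phi> where "\<phi> y p = mpoly.representation B p y" for y p
  define c where "c y k = \<phi> y (Poly_Mapping.single (Poly_Mapping.single k 1) 1)" for y k
  have in_span: "p \<in> mpoly.span B" for p
    using B(3) by auto
  have D: "derivation n (c y) p = Poly_Mapping.single 0 (\<phi> y p)" if "p \<in> homogeneous n 1" for y p
    unfolding c_def
    by (rule derivation_linear_form[OF _ _ that])
      (simp_all add: \<phi>_def mpoly.representation_add mpoly.representation_scale B(2) in_span)
  show thesis
  proof (rule that)
    show "\<forall>y. \<forall>p\<in>homogeneous n 1. \<exists>a. derivation n (c y) p = Poly_Mapping.single 0 a"
      using D by blast
    show "\<forall>y\<in>Y. \<forall>p\<in>W. derivation n (c y) p = 0"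
    proof (intro ballI)
      fix y p assume y: "y \<in> Y" and p: "p \<in> W"
      \<comment> \<open>A common element of \<open>Y\<close> and \<open>Z\<close> would be zero,
        which independence excludes. Hence \<open>y\<close> does not occur when \<open>p\<close> is
        expanded in \<open>Z\<close>.\<close>
      have "y \<notin> Z"
      proof
        assume "y \<in> Z"
        then have "y = 0"
          using y Y(1) Z(1) TW by blast
        then show False
          using y Y(2) mpoly.dependent_zero by blast
      qed
      moreover have "mpoly.representation B p = mpoly.representation Z p"
        using Z(3) p B(1) by (intro mpoly.representation_extend B(2)) auto
      ultimately have "\<phi> y p = 0"
        unfolding \<phi>_def using mpoly.representation_ne_zero by metis
      then show "derivation n (c y) p = 0"
        using D[of p y] p W(2) by auto
    qed
    show "\<forall>p\<in>T. (\<Sum>y\<in>Y. y * derivation n (c y) p) = p"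
    proof
      fix p assume p: "p \<in> T"
      have "mpoly.representation B p = mpoly.representation Y p"
        using Y(3) p B(1) by (intro mpoly.representation_extend B(2)) auto
      then have "(\<Sum>y\<in>Y. scale_mpoly (\<phi> y p) y) = p"
        using mpoly.sum_representation_eq[OF Y(2) _ \<open>finite Y\<close>] p Y(3)
        by (auto simp: \<phi>_def)
      then show "(\<Sum>y\<in>Y. y * derivation n (c y) p) = p"
        using D[of p] p T(2) by (auto simp: scale_mpoly_def mult.commute)
    qed
  qed
qed

section \<open>Direct sums\<close>

text \<open>The sums form a subspace containing every \<open>U i\<close>. Thus the surjectivity half
  of \<open>direct_sum_family\<close> is automatic.\<close>

lemma span_UN_eq_sums:
  assumes I: "finite I" and U: "\<And>i. i \<in> I \<Longrightarrow> mpoly.subspace (U i)"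
  shows "mpoly.span (\<Union>i\<in>I. U i) = (\<lambda>f. \<Sum>i\<in>I. f i) ` (\<Pi>\<^sub>E i\<in>I. U i)" (is "_ = ?R")
proof
  show "?R \<subseteq> mpoly.span (\<Union>i\<in>I. U i)"
    by (auto intro!: mpoly.span_sum intro: mpoly.span_base)
  \<comment> \<open>Members of the extensional product must be \<open>undefined\<close> outside
    \<open>I\<close>; restricting a function arranges this without changing the sum.\<close>
  have restr: "(\<Sum>i\<in>I. f i) \<in> ?R" if "\<And>i. i \<in> I \<Longrightarrow> f i \<in> U i" for f
    using that by (intro image_eqI[of _ _ "restrict f I"]) auto
  have "mpoly.subspace ?R"
    unfolding mpoly.subspace_def
  proof (intro conjI ballI allI)
    show "0 \<in> ?R"
      using restr[of "\<lambda>_. 0"] U by (simp add: mpoly.subspace_0)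
  next
    fix p q assume "p \<in> ?R" "q \<in> ?R"
    then obtain f g where fg: "f \<in> (\<Pi>\<^sub>E i\<in>I. U i)" "g \<in> (\<Pi>\<^sub>E i\<in>I. U i)"
        "p = (\<Sum>i\<in>I. f i)" "q = (\<Sum>i\<in>I. g i)" by blast
    then have "(\<Sum>i\<in>I. f i + g i) \<in> ?R"
      by (intro restr mpoly.subspace_add[OF U]) auto
    then show "p + q \<in> ?R" by (simp add: fg sum.distrib)
  next
    fix a p assume "p \<in> ?R"
    then obtain f where f: "f \<in> (\<Pi>\<^sub>E i\<in>I. U i)" "p = (\<Sum>i\<in>I. f i)" by blast
    then have "(\<Sum>i\<in>I. scale_mpoly a (f i)) \<in> ?R"
      by (intro restr mpoly.subspace_scale[OF U]) auto
    then show "scale_mpoly a p \<in> ?R" by (simp add: f mpoly.scale_sum_right)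
  qed
  moreover have "U i \<subseteq> ?R" if i: "i \<in> I" for i
  proof
    fix p assume "p \<in> U i"
    then have "(\<Sum>j\<in>I. if j = i then p else 0) \<in> ?R"
      by (intro restr) (auto intro: mpoly.subspace_0 U)
    then show "p \<in> ?R" using I i by simp
  qed
  ultimately show "mpoly.span (\<Union>i\<in>I. U i) \<subseteq> ?R"
    by (intro mpoly.span_minimal) auto
qed

text \<open>Only injectivity of the addition map is left to check, and by linearity this means
  trivial kernel.\<close>

lemma direct_sum_family_iff:
  assumes I: "finite I" and U: "\<And>i. i \<in> I \<Longrightarrow> mpoly.subspace (U i)"
  shows "direct_sum_family U I \<longleftrightarrow>
    (\<forall>f. (\<forall>i\<in>I. f i \<in> U i) \<and> (\<Sum>i\<in>I. f i) = 0 \<longrightarrow> (\<forall>i\<in>I. f i = 0))" (is "_ \<longleftrightarrow> ?R")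
proof -
  let ?P = "\<Pi>\<^sub>E i\<in>I. U i"
  have "direct_sum_family U I \<longleftrightarrow> inj_on (\<lambda>f. \<Sum>i\<in>I. f i) ?P"
    using span_UN_eq_sums[OF I U] by (simp add: direct_sum_family_def bij_betw_def)
  also have "\<dots> \<longleftrightarrow> ?R"
  proof
    assume inj: "inj_on (\<lambda>f. \<Sum>i\<in>I. f i) ?P"
    show ?R
    proof (intro allI impI, elim conjE)
      fix f assume f: "\<forall>i\<in>I. f i \<in> U i" "(\<Sum>i\<in>I. f i) = 0"
      have "restrict f I = restrict (\<lambda>_. 0) I"
        using f by (intro inj_onD[OF inj]) (auto intro: mpoly.subspace_0 U)
      then show "\<forall>i\<in>I. f i = 0"
        by (metis restrict_apply')
    qed
  next
    assume R: ?R
    show "inj_on (\<lambda>f. \<Sum>i\<in>I. f i) ?P"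
    proof (rule inj_onI)
      fix f g assume fg: "f \<in> ?P" "g \<in> ?P" "(\<Sum>i\<in>I. f i) = (\<Sum>i\<in>I. g i)"
      have "\<forall>i\<in>I. f i - g i \<in> U i"
        using fg by (auto intro!: mpoly.subspace_diff U)
      moreover have "(\<Sum>i\<in>I. f i - g i) = 0"
        using fg by (simp add: sum_subtractf)
      ultimately have "\<forall>i\<in>I. f i - g i = 0"
        using R[rule_format, of "\<lambda>i. f i - g i"] by blast
      then show "f = g"
        using fg by (intro PiE_ext[of f I U g]) auto
    qed
  qed
  finally show ?thesis .
qed

text \<open>Passes from an indexed family to the set of its members, as used in
  \<open>k_independent\<close>; injectivity keeps distinct indices from merging.\<close>

lemma direct_sum_family_image:
  assumes "finite I" and U: "\<And>i. i \<in> I \<Longrightarrow> mpoly.subspace (U i)" and inj: "inj_on U I"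
    and "direct_sum_family U I"
  shows "direct_sum_family (\<lambda>V. V) (U ` I)"
proof -
  have "\<forall>V\<in>U ` I. f V = 0" if f: "\<forall>V\<in>U ` I. f V \<in> V" "(\<Sum>V\<in>U ` I. f V) = 0" for f
  proof -
    have "(\<Sum>i\<in>I. f (U i)) = 0"
      using f(2) sum.reindex[OF inj, of f] by simp
    moreover have "\<forall>i\<in>I. f (U i) \<in> U i"
      using f(1) by blast
    ultimately show ?thesis
      using assms(4) direct_sum_family_iff[OF assms(1) U] \<open>(\<Sum>i\<in>I. f (U i)) = 0\<close>
      by (auto dest: spec[of _ "\<lambda>i. f (U i)"])
  qed
  then show ?thesis
    using assms(1) U by (subst direct_sum_family_iff) auto
qed

lemma direct_sum_family_Int_span:
  assumes "direct_sum_family U (insert j I)" and "finite I" and "j \<notin> I"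
    and U: "\<And>i. i \<in> insert j I \<Longrightarrow> mpoly.subspace (U i)"
  shows "U j \<inter> mpoly.span (\<Union>i\<in>I. U i) \<subseteq> {0}"
proof
  fix p assume p: "p \<in> U j \<inter> mpoly.span (\<Union>i\<in>I. U i)"
  then obtain g where g: "\<forall>i\<in>I. g i \<in> U i" "p = (\<Sum>i\<in>I. g i)"
    using span_UN_eq_sums[of I U] assms(2) U by (auto simp: PiE_iff)
  \<comment> \<open>Moving \<open>p\<close> to the other side turns the equation for
    \<open>p\<close> into a relation with \<open>- p\<close> in slot \<open>j\<close>.\<close>
  define f where "f = g(j := - p)"
  have "\<forall>i\<in>insert j I. f i \<in> U i"
    using g p assms(3) U by (auto simp: f_def mpoly.subspace_neg)
  moreover have "(\<Sum>i\<in>I. f i) = (\<Sum>i\<in>I. g i)"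
    using assms(3) by (intro sum.cong) (auto simp: f_def)
  then have "(\<Sum>i\<in>insert j I. f i) = 0"
    using assms(2,3) g(2) by (simp add: f_def)
  ultimately have "f j = 0"
    using assms(1,2) direct_sum_family_iff[of "insert j I" U] U by blast
  then show "p \<in> {0}" by (simp add: f_def)
qed

section \<open>The independence theorem\<close>

text \<open>The quotient is a falling factorial. Its top factor is the number to cancel in Euler's
  identity; the rest must be nonzero for the induction hypothesis.\<close>

lemma fact_div_fact_Suc:
  assumes "r \<le> d"
  shows "fact (Suc d) div fact (Suc d - Suc r) = Suc d * (fact d div fact (d - r) :: nat)"
  using fact_dvd[of "d - r" d, where 'a = nat] assms
  by (simp only: diff_Suc_Suc fact_Suc of_nat_id div_mult_swap diff_le_self)

text \<open>The assumption \<open>disj\<close> passes to subsets of \<open>S\<close>, so the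
  induction can keep \<open>T\<close> fixed and drop \<open>e\<close> members of \<open>S\<close>
  each time, while \<open>r\<close> and \<open>d\<close> decrease together.\<close>

lemma eq_0_of_eq_sum_power_span:
  fixes T :: "'a::field mpoly set" and f :: "'a mpoly"
  assumes T: "mpoly.subspace T" "T \<subseteq> homogeneous n 1"
    and S: "finite S" "card S = r * e" "\<And>U. U \<in> S \<Longrightarrow> U \<subseteq> homogeneous n 1"
    and disj: "\<And>B. B \<subseteq> S \<Longrightarrow> card B = e \<Longrightarrow> T \<inter> mpoly.span (\<Union>B) \<subseteq> {0}"
    and rd: "r \<le> d" "(of_nat (fact d div fact (d - r)) :: 'a) \<noteq> 0"
    and f: "f \<in> power_span d T" "f = (\<Sum>U\<in>S. g U)" and g: "\<And>U. U \<in> S \<Longrightarrow> g U \<in> power_span d U"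
  shows "f = 0"
  using S disj rd f g
proof (induction r arbitrary: d S f g)
  case 0
  \<comment> \<open>Here \<open>S\<close> is empty, so \<open>f\<close> is an empty sum.\<close>
  then show ?case by simp
next
  case (Suc r d' S f g)
  obtain d where d': "d' = Suc d" and "r \<le> d"
    using Suc.prems(5) by (cases d') auto
  have nz: "(of_nat (Suc d) :: 'a) \<noteq> 0" "(of_nat (fact d div fact (d - r)) :: 'a) \<noteq> 0"
    using Suc.prems(6) unfolding d' fact_div_fact_Suc[OF \<open>r \<le> d\<close>] of_nat_mult by auto
  have "e \<le> card S"
    using Suc.prems(2) by simp
  then obtain B where B: "B \<subseteq> S" "card B = e" "finite B"
    by (rule obtain_subset_with_card_n)
  let ?W = "mpoly.span (\<Union>B)"
  have "?W \<subseteq> homogeneous n 1"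
    using B(1) Suc.prems(3) by (intro mpoly.span_minimal subspace_homogeneous) blast
  from this Suc.prems(4)[OF B(1,2)] obtain c Y where
      const: "\<forall>y. \<forall>p\<in>homogeneous n 1. \<exists>a. derivation n (c y) p = Poly_Mapping.single 0 a" and
      kill: "\<forall>y\<in>Y. \<forall>p\<in>?W. derivation n (c y) p = 0" and
      dual: "\<forall>p\<in>T. (\<Sum>y\<in>Y. y * derivation n (c y) p) = p"
    by (rule dual_derivations[OF T mpoly.subspace_span])
  have "derivation n (c y) f = 0" if y: "y \<in> Y" for y
  proof (rule Suc.IH[of "S - B" d])
    show "card (S - B) = r * e"
      using Suc.prems(1,2) B by (simp add: card_Diff_subset)
    show "derivation n (c y) f \<in> power_span d T"
      using Suc.prems(7) const T(2) unfolding d' by (intro derivation_power_span) blast+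
    \<comment> \<open>Each \<open>U\<close> in \<open>B\<close> lies in \<open>?W\<close>, where the
      derivation vanishes, so only summands over \<open>S - B\<close> can survive.\<close>
    have "derivation n (c y) (g U) = 0" if "U \<in> B" for U
    proof (rule derivation_power_span_eq_0)
      show "g U \<in> power_span d' U"
        using that B(1) Suc.prems(9) by blast
      show "derivation n (c y) t = 0" if "t \<in> U" for t
        using that \<open>U \<in> B\<close> by (intro kill[rule_format, OF y] mpoly.span_base) blast
    qed
    then have "(\<Sum>U\<in>S. derivation n (c y) (g U)) = (\<Sum>U\<in>S - B. derivation n (c y) (g U))"
      using Suc.prems(1) B(1) by (intro sum.mono_neutral_right) auto
    then show "derivation n (c y) f = (\<Sum>U\<in>S - B. derivation n (c y) (g U))"
      by (simp add: Suc.prems(8) derivation_sum)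
    show "derivation n (c y) (g U) \<in> power_span d U" if "U \<in> S - B" for U
      using that Suc.prems(3)[of U] Suc.prems(9)[of U] const unfolding d'
      by (intro derivation_power_span) blast+
    show "finite (S - B)" "\<And>U. U \<in> S - B \<Longrightarrow> U \<subseteq> homogeneous n 1"
      using Suc.prems(1,3) by auto
    show "T \<inter> mpoly.span (\<Union>C) \<subseteq> {0}" if "C \<subseteq> S - B" "card C = e" for C
      using that by (intro Suc.prems(4)) auto
  qed (fact \<open>r \<le> d\<close> nz(2))+
  \<comment> \<open>Every derivative in Euler's identity is zero, which leaves \<open>d'\<close>
    times \<open>f\<close>, and \<open>d'\<close> is nonzero in the field.\<close>
  then have "of_nat d' * f = 0"
    using euler_identity[OF dual[rule_format] Suc.prems(7)] by simp
  then have "scale_mpoly (of_nat d') f = 0"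
    by (simp add: scale_mpoly_def)
  then show ?case
    using nz(1) by (simp add: d' del: of_nat_Suc)
qed

text \<open>There are no zero divisors, so a power of a nonzero element is nonzero. This serves to
  separate the power spans of distinct members.\<close>

lemma power_span_nonzero:
  assumes "mpoly.subspace T" and "T \<noteq> {0}"
  obtains p where "p \<in> power_span d T" and "p \<noteq> 0"
proof -
  obtain t where t: "t \<in> T" "t \<noteq> 0"
    using assms mpoly.subspace_0 by blast
  have "(\<Prod>i<d. t) \<in> power_span d T"
    unfolding power_span_def using t by (intro mpoly.span_base CollectI exI[of _ "\<lambda>_. t"]) auto
  moreover have "(\<Prod>i<d. t) \<noteq> 0"
    using t by simp
  ultimately show thesis by (rule that)
qed

theorem theorem1p4:
  fixes n d e r :: nat
    and \<T> :: "'a::field mpoly set set"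
  assumes "n > 1" and "d > 1" and "e \<ge> 1"
    and "1 \<le> r" and "r \<le> d"
    and "(of_nat (fact d div fact (d - r)) :: 'a) \<noteq> 0"
    and "\<forall>T\<in>\<T>. T \<subseteq> homogeneous n 1 \<and> mpoly.subspace T \<and> T \<noteq> {0}"
    and "finite \<T> \<longrightarrow> r * e + 1 \<le> card \<T>"
    and "k_independent (e + 1) \<T>"
  shows "(\<forall>T\<in>\<T>. power_span d T \<subseteq> homogeneous n d)
    \<and> k_independent (r * e + 1) (power_span d ` \<T>)
    \<and> (\<forall>F. F \<subseteq> \<T> \<and> finite F \<and> card F = r * e + 1 \<longrightarrow>
          direct_sum_family (power_span d) F)"
proof -
  \<comment> \<open>\<open>T\<close> and the members of \<open>B\<close> are \<open>e + 1\<close>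
    distinct subspaces, so their sum is direct.\<close>
  have disj: "T \<inter> mpoly.span (\<Union>B) \<subseteq> {0}"
    if "insert T B \<subseteq> \<T>" "finite B" "card B = e" "T \<notin> B" for T B
  proof -
    have "direct_sum_family (\<lambda>U. U) (insert T B)"
      using assms(9) that by (simp add: k_independent_def)
    then show ?thesis
      using direct_sum_family_Int_span[of "\<lambda>U. U" T B] that assms(7) by auto
  qed
  have direct: "direct_sum_family (power_span d) F"
    if F: "F \<subseteq> \<T>" "finite F" "card F = r * e + 1" for F
    unfolding direct_sum_family_iff[OF F(2) subspace_power_span]
  proof (intro allI impI ballI, elim conjE)
    fix f T assume f: "\<forall>U\<in>F. f U \<in> power_span d U" "(\<Sum>U\<in>F. f U) = 0" and T: "T \<in> F"
    show "f T = 0"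
    proof (rule eq_0_of_eq_sum_power_span)
      \<comment> \<open>Isolating one summand leaves \<open>r * e\<close> others, as the key lemma
        requires.\<close>
      show "f T = (\<Sum>U\<in>F - {T}. - f U)"
        using f(2) sum.remove[OF F(2) T, of f] by (simp add: sum_negf eq_neg_iff_add_eq_0)
      show "T \<inter> mpoly.span (\<Union>B) \<subseteq> {0}" if "B \<subseteq> F - {T}" "card B = e" for B
        using that F T by (intro disj) (auto intro: finite_subset)
      show "- f U \<in> power_span d U" if "U \<in> F - {T}" for U
        using that f(1) by (intro mpoly.subspace_neg[OF subspace_power_span]) auto
      show "mpoly.subspace T" "T \<subseteq> homogeneous n 1" "\<And>U. U \<in> F - {T} \<Longrightarrow> U \<subseteq> homogeneous n 1"
        using assms(7) F(1) T by auto
      show "finite (F - {T})" "card (F - {T}) = r * e" "f T \<in> power_span d T"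
        using F T f(1) by auto
    qed (fact assms(5,6))+
  qed
  \<comment> \<open>Injectivity guarantees that the set of power spans is as large as \<T> and that
    its subsets come from subfamilies of the same size.\<close>
  have inj: "inj_on (power_span d) \<T>"
  proof (rule inj_onI, rule ccontr)
    fix T U assume TU: "T \<in> \<T>" "U \<in> \<T>" "power_span d T = power_span d U" "T \<noteq> U"
    obtain p where p: "p \<in> power_span d T" "p \<noteq> 0"
      using power_span_nonzero assms(7) TU(1) by metis
    \<comment> \<open>This makes \<open>r * e + 1\<close> at least 2, so some \<open>F\<close> of
      that size contains both \<open>T\<close> and \<open>U\<close>.\<close>
    have "r * e \<ge> 1"
      using assms(3,4) by simp
    then have "card {T, U} \<le> r * e + 1"
      using TU(4) by simp
    then obtain F where F: "{T, U} \<subseteq> F" "F \<subseteq> \<T>" "finite F" "card F = r * e + 1"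
    proof (cases "finite \<T>")
      case True
      then show ?thesis
        using exists_subset_between[of "{T, U}" "r * e + 1" \<T>] assms(8) TU
          \<open>card {T, U} \<le> r * e + 1\<close> that finite_subset
        by (metis bot_least insert_subset)
    next
      case False
      then obtain G where G: "finite G" "card G = r * e + 1 - card {T, U}" "G \<subseteq> \<T> - {T, U}"
        by (metis finite.emptyI finite_Diff2 finite_insert infinite_arbitrarily_large)
      then have "card ({T, U} \<union> G) = r * e + 1"
        using \<open>card {T, U} \<le> r * e + 1\<close> by (subst card_Un_disjoint) auto
      then show ?thesis
        using that[of "{T, U} \<union> G"] G TU by blast
    qed
    \<comment> \<open>Placing \<open>p\<close> and \<open>- p\<close> in the two equal power spans
      gives a nontrivial relation, which directness over \<open>F\<close> forbids.\<close>
    define f where "f V = (if V = T then p else if V = U then - p else 0)" for V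
    have "(\<Sum>V\<in>F. f V) = (\<Sum>V\<in>{T, U}. f V)"
      using F by (intro sum.mono_neutral_right) (auto simp: f_def)
    then have "(\<Sum>V\<in>F. f V) = 0"
      using TU(4) by (simp add: f_def)
    moreover have "\<forall>V\<in>F. f V \<in> power_span d V"
      using p(1) TU(3)
      by (simp add: f_def subspace_power_span mpoly.subspace_0 mpoly.subspace_neg)
    ultimately have "f T = 0"
      using direct[OF F(2-4)] F(1)
      unfolding direct_sum_family_iff[OF F(3) subspace_power_span] by (auto dest: spec[of _ f])
    then show False
      using p(2) by (simp add: f_def)
  qed
  have "k_independent (r * e + 1) (power_span d ` \<T>)"
    unfolding k_independent_def
  proof (intro conjI allI impI)
    show "\<forall>U\<in>power_span d ` \<T>. mpoly.subspace U"
      by (auto simp: subspace_power_span)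
    show "r * e + 1 \<le> card (power_span d ` \<T>)" if "finite (power_span d ` \<T>)"
      using that assms(8) inj by (simp add: card_image finite_image_iff)
    show "direct_sum_family (\<lambda>U. U) G"
      if G: "G \<subseteq> power_span d ` \<T> \<and> finite G \<and> card G = r * e + 1" for G
    proof -
      obtain F where F: "F \<subseteq> \<T>" "G = power_span d ` F"
        using G by (meson subset_imageE)
      have inj_F: "inj_on (power_span d) F"
        using inj F(1) by (rule inj_on_subset)
      then have "finite F" "card F = r * e + 1"
        using G F(2) by (simp_all add: card_image finite_image_iff)
      then show ?thesis
        using direct_sum_family_image[OF _ subspace_power_span inj_F] direct F by simp
    qed
  qed
  then show ?thesis
    using direct power_span_subset_homogeneous assms(7) by blast
qed

end
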